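(* Let $(X_1,\mathbf{T}_1)$ be a minimal $\mathbb{Z}^{d_1}$-Cantor system and let $(X_2,\mathbf{T}_2)$ be a minimal $\mathbb{Z}^{d_2}$-Cantor system. Suppose there is a speedup $\mathbf{S}:\mathbb{Z}^{d_2}\curvearrowright X_1$ of $\mathbf{T}_1$ that is conjugate to $\mathbf{T}_2$. Then: (1) there is a homeomorphism $F:X_1\to X_2$ such that $F^*$, given by $F^*(\mu)(A)=\mu(F^{-1}(A))$ for Borel $A\subseteq X_2$, is an injective map from $\mathcal{M}(X_1,\mathbf{T}_1)$ to $\mathcal{M}(X_2,\mathbf{T}_2)$; and (2) there is a surjective group homomorphism $\varphi:G(X_2,\mathbf{T}_2)\to G(X_1,\mathbf{T}_1)$ between the dimension groups such that $\varphi(G(X_2,\mathbf{T}_2)^+)=G(X_1,\mathbf{T}_1)^+$ and $\varphi(1+Z_{\mathbf{T}_2})=1+Z_{\mathbf{T}_1}$.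
   Context: A $\mathbb{Z}^d$-action $\mathbf{T}:\mathbb{Z}^d\curvearrowright X$ on a topological space $X$ assigns to each $\mathbf{v}\in\mathbb{Z}^d$ a homeomorphism $\mathbf{T}^{\mathbf{v}}:X\to X$ with $\mathbf{T}^{\mathbf{v}+\mathbf{w}}=\mathbf{T}^{\mathbf{v}}\circ\mathbf{T}^{\mathbf{w}}$ and $\mathbf{T}^{\mathbf{0}}=\mathrm{id}$. It is minimal if every orbit is dense; a minimal $\mathbb{Z}^d$-Cantor system is a minimal $\mathbb{Z}^d$-action on a Cantor space. $\mathcal{M}(X,\mathbf{T})$ is the set of Borel probability measures on $X$ invariant under every $\mathbf{T}^{\mathbf{v}}$. Actions $\mathbf{T}:\mathbb{Z}^d\curvearrowright X$ and $\mathbf{S}:\mathbb{Z}^d\curvearrowright Y$ are conjugate if there is a homeomorphism $\Phi:X\to Y$ with $\Phi\circ\mathbf{T}^{\mathbf{v}}=\mathbf{S}^{\mathbf{v}}\circ\Phi$ for all $\mathbf{v}$. A cocycle for $\mathbf{T}:\mathbb{Z}^{d_1}\curvearrowright X$ is a function $\mathbf{p}:X\times\mathbb{Z}^{d_2}\to\mathbb{Z}^{d_1}$ with $\mathbf{p}(x,\mathbf{0})=\mathbf{0}$ and $\mathbf{p}(x,\mathbf{v})+\mathbf{p}(\mathbf{T}^{\mathbf{p}(x,\mathbf{v})}(x),\mathbf{w})=\mathbf{p}(x,\mathbf{v}+\mathbf{w})$ for all $x\in X$ and $\mathbf{v},\mathbf{w}\in\mathbb{Z}^{d_2}$. A speedup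 of $(X,\mathbf{T})$ is an action (by homeomorphisms) $\mathbf{S}:\mathbb{Z}^{d_2}\curvearrowright X$ with $\mathbf{S}^{\mathbf{v}}(x)=\mathbf{T}^{\mathbf{p}(x,\mathbf{v})}(x)$ for some cocycle $\mathbf{p}$ for $\mathbf{T}$. No continuity or boundedness of $\mathbf{p}$ is assumed. For a minimal $\mathbb{Z}^d$-Cantor system $(X,\mathbf{T})$, let $C(X,\mathbb{Z})$ be the additive group of continuous functions $X\to\mathbb{Z}$ and $Z_{\mathbf{T}}=\{f\in C(X,\mathbb{Z}):\int f\,d\mu=0\text{ for all }\mu\in\mathcal{M}(X,\mathbf{T})\}$. The dimension group associated to the system is $G(X,\mathbf{T})=C(X,\mathbb{Z})/Z_{\mathbf{T}}$; its positive cone $G(X,\mathbf{T})^+$ is the set of cosets containing some $g\in C(X,\mathbb{Z})$ with $g(x)\ge 0$ for all $x\in X$; its order unit is $1+Z_{\mathbf{T}}$, the coset of the constant function $1$. *)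

theory Defs
  imports "HOL-Analysis.Analysis" "HOL-Probability.Probability_Measure" "HOL-Algebra.Coset"
begin

text \<open>Spaces are types of class \<^class>\<open>topological_space\<close>, and \<open>\<int>\<^sup>d\<close> is
  \<^typ>\<open>int ^ 'd\<close> with \<open>d = CARD('d)\<close>, which is at least 1.  An action of \<open>\<int>\<^sup>0\<close> on a Cantor
  space is never minimal, so excluding \<open>d = 0\<close> loses nothing.\<close>

definition zd_action :: "(int ^ 'd \<Rightarrow> 'a \<Rightarrow> 'a::topological_space) \<Rightarrow> bool" where
  "zd_action T \<longleftrightarrow>
     (\<forall>v. \<exists>g. homeomorphism UNIV UNIV (T v) g) \<and>
     (\<forall>v w. T (v + w) = T v \<circ> T w) \<and> T 0 = id"

definition minimal_action :: "(int ^ 'd \<Rightarrow> 'a \<Rightarrow> 'a::topological_space) \<Rightarrow> bool" where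
  "minimal_action T \<longleftrightarrow> zd_action T \<and> (\<forall>x. closure (range (\<lambda>v. T v x)) = UNIV)"

text \<open>The topology on \<^typ>\<open>nat \<Rightarrow> bool\<close> is the product of the discrete topologies.\<close>

definition cantor_space :: "'a::topological_space itself \<Rightarrow> bool" where
  "cantor_space _ \<longleftrightarrow> (UNIV :: 'a set) homeomorphic (UNIV :: (nat \<Rightarrow> bool) set)"

definition minimal_cantor_system :: "(int ^ 'd \<Rightarrow> 'a \<Rightarrow> 'a::topological_space) \<Rightarrow> bool" where
  "minimal_cantor_system T \<longleftrightarrow> cantor_space TYPE('a) \<and> minimal_action T"

definition invariant_measures ::
  "(int ^ 'd \<Rightarrow> 'a \<Rightarrow> 'a::topological_space) \<Rightarrow> 'a measure set" where
  "invariant_measures T =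
     {M. prob_space M \<and> sets M = sets borel \<and>
         (\<forall>v. \<forall>A\<in>sets borel. emeasure M (T v -` A) = emeasure M A)}"

definition conjugate_actions ::
  "(int ^ 'd \<Rightarrow> 'a \<Rightarrow> 'a::topological_space) \<Rightarrow> (int ^ 'd \<Rightarrow> 'b \<Rightarrow> 'b::topological_space) \<Rightarrow> bool" where
  "conjugate_actions T S \<longleftrightarrow>
     (\<exists>\<Phi> \<Psi>. homeomorphism UNIV UNIV \<Phi> \<Psi> \<and> (\<forall>v. \<Phi> \<circ> T v = S v \<circ> \<Phi>))"

definition cocycle :: "(int ^ 'd \<Rightarrow> 'a \<Rightarrow> 'a) \<Rightarrow> ('a \<Rightarrow> int ^ 'e \<Rightarrow> int ^ 'd) \<Rightarrow> bool" where
  "cocycle T p \<longleftrightarrow>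
     (\<forall>x. p x 0 = 0) \<and> (\<forall>x v w. p x v + p (T (p x v) x) w = p x (v + w))"

definition speedup ::
  "(int ^ 'd \<Rightarrow> 'a \<Rightarrow> 'a::topological_space) \<Rightarrow> (int ^ 'e \<Rightarrow> 'a \<Rightarrow> 'a) \<Rightarrow> bool" where
  "speedup T S \<longleftrightarrow> zd_action S \<and> (\<exists>p. cocycle T p \<and> (\<forall>v x. S v x = T (p x v) x))"

text \<open>\<open>HOL-Algebra\<close> groups are written multiplicatively, so the additive group \<open>C(X, \<int>)\<close> has
  pointwise addition in the \<open>mult\<close> field; \<^typ>\<open>int\<close> carries the discrete topology.\<close>

definition C_int :: "('a::topological_space \<Rightarrow> int) monoid" where
  "C_int = \<lparr>carrier = {f. continuous_on UNIV f}, mult = (\<lambda>f g x. f x + g x), one = (\<lambda>_. 0)\<rparr>"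

definition Z_null :: "(int ^ 'd \<Rightarrow> 'a \<Rightarrow> 'a::topological_space) \<Rightarrow> ('a \<Rightarrow> int) set" where
  "Z_null T = {f \<in> carrier C_int. \<forall>M\<in>invariant_measures T. (\<integral>x. real_of_int (f x) \<partial>M) = 0}"

definition dim_group ::
  "(int ^ 'd \<Rightarrow> 'a \<Rightarrow> 'a::topological_space) \<Rightarrow> ('a \<Rightarrow> int) set monoid" where
  "dim_group T = C_int Mod Z_null T"

definition dim_group_pos ::
  "(int ^ 'd \<Rightarrow> 'a \<Rightarrow> 'a::topological_space) \<Rightarrow> ('a \<Rightarrow> int) set set" where
  "dim_group_pos T =
     {c \<in> carrier (dim_group T). \<exists>g \<in> c. g \<in> carrier C_int \<and> (\<forall>x. g x \<ge> 0)}"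

definition dim_group_unit ::
  "(int ^ 'd \<Rightarrow> 'a \<Rightarrow> 'a::topological_space) \<Rightarrow> ('a \<Rightarrow> int) set" where
  "dim_group_unit T = Z_null T #>\<^bsub>C_int\<^esub> (\<lambda>_. 1)"

lemma C_int_uminus:
  fixes f :: "'a::topological_space \<Rightarrow> int"
  assumes "continuous_on UNIV f"
  shows "continuous_on UNIV (\<lambda>x. - f x)"
  using assms continuous_on_discrete[of UNIV "uminus :: int \<Rightarrow> int"]
  by (auto intro: continuous_on_compose2)

lemma comm_group_C_int: "comm_group C_int"
proof (rule comm_groupI)
  fix f :: "'a \<Rightarrow> int" assume "f \<in> carrier C_int"
  then show "\<exists>g\<in>carrier C_int. g \<otimes>\<^bsub>C_int\<^esub> f = \<one>\<^bsub>C_int\<^esub>"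
    using C_int_uminus[of f]
    by (intro bexI[of _ "\<lambda>x. - f x"]) (auto simp: C_int_def)
qed (auto simp: C_int_def algebra_simps intro!: continuous_intros)

lemma integrable_C_int:
  assumes "cantor_space TYPE('a::topological_space)"
    and "M \<in> invariant_measures T" and "f \<in> carrier (C_int :: ('a \<Rightarrow> int) monoid)"
  shows "integrable M (\<lambda>x. real_of_int (f x))"
proof -
  interpret prob_space M using assms(2) by (simp add: invariant_measures_def)
  have f: "continuous_on UNIV (\<lambda>x. real_of_int (f x))"
    using assms(3) by (auto simp: C_int_def intro!: continuous_intros)
  have "compact_space (product_topology (\<lambda>_::nat. euclidean :: bool topology) UNIV)"
    unfolding compact_space_product_topology
    by (simp add: compact_space_def finite_imp_compact)
  then have "compact (UNIV :: (nat \<Rightarrow> bool) set)"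
    by (simp add: compact_space_def euclidean_product_topology)
  then have "compact (UNIV :: 'a set)"
    using assms(1) unfolding cantor_space_def by (simp add: homeomorphic_compactness)
  then have "bounded (range (\<lambda>x. real_of_int (f x)))"
    using f by (intro compact_imp_bounded compact_continuous_image)
  then obtain B where "\<And>x. norm (real_of_int (f x)) \<le> B"
    unfolding bounded_iff by auto
  moreover have "(\<lambda>x. real_of_int (f x)) \<in> borel_measurable M"
    using borel_measurable_continuous_onI[OF f] assms(2)
    by (simp add: invariant_measures_def cong: measurable_cong_sets)
  ultimately show ?thesis by (intro integrable_const_bound[of _ B]) auto
qed

lemma comm_group_dim_group:
  fixes T :: "int ^ 'd \<Rightarrow> 'a \<Rightarrow> 'a::topological_space"
  assumes "minimal_cantor_system T"
  shows "comm_group (dim_group T)"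
proof -
  interpret C: comm_group C_int by (rule comm_group_C_int)
  have "cantor_space TYPE('a)" using assms by (simp add: minimal_cantor_system_def)
  note int = integrable_C_int[OF this]
  have inv: "inv\<^bsub>C_int\<^esub> f = (\<lambda>x. - f x)" if "f \<in> carrier C_int" for f :: "'a \<Rightarrow> int"
    using that C_int_uminus[of f]
    by (intro C.inv_equality) (auto simp: C_int_def)
  have "subgroup (Z_null T) C_int"
  proof (rule C.subgroupI)
    show "Z_null T \<subseteq> carrier C_int" by (auto simp: Z_null_def)
    have "(\<lambda>_. 0) \<in> Z_null T" by (simp add: Z_null_def C_int_def)
    then show "Z_null T \<noteq> {}" by blast
  next
    fix f assume f: "f \<in> Z_null T"
    then have "f \<in> carrier C_int" by (simp add: Z_null_def)
    then show "inv\<^bsub>C_int\<^esub> f \<in> Z_null T"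
      using f C.inv_closed[of f] by (simp add: inv Z_null_def)
  next
    fix f g assume f: "f \<in> Z_null T" and g: "g \<in> Z_null T"
    then have "f \<otimes>\<^bsub>C_int\<^esub> g \<in> carrier C_int" by (simp add: Z_null_def)
    moreover have "f \<otimes>\<^bsub>C_int\<^esub> g = (\<lambda>x. f x + g x)" by (simp add: C_int_def)
    ultimately show "f \<otimes>\<^bsub>C_int\<^esub> g \<in> Z_null T"
      using f g by (simp add: Z_null_def int)
  qed
  then show ?thesis
    unfolding dim_group_def by (rule C.abelian_FactGroup)
qed

end

theory Submission
  imports Defs
begin

text \<open>
  Everything rests on one inclusion: a speedup \<open>S\<close> of \<open>T\<close> preserves every \<open>T\<close>-invariant
  measure (\<open>invariant_measures_subset_speedup\<close>).  Each \<open>S\<^sup>v\<close> moves points inside \<open>T\<close>-orbits,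
  and \<open>\<int>\<^sup>d\<close> is countable, so \<open>X\<close> splits into countably many pieces on each of which \<open>S\<^sup>v\<close>
  is a single \<open>T\<^sup>w\<close>.  On a piece, \<open>S\<^sup>v\<close> therefore preserves measure; since \<open>S\<^sup>v\<close> is a
  bijection, the images of the pieces are again disjoint and cover \<open>X\<close>, and summation gives
  invariance.  The inclusion can be strict, because \<open>S\<close>-orbits may be much smaller than
  \<open>T\<close>-orbits; this is why the conclusions are an injection of measures and a surjection of
  groups.

  The pieces have to be Borel.  The sets \<open>{x. p x v = w}\<close> for a cocycle \<open>p\<close> need not be, as no
  regularity of \<open>p\<close> is assumed.  The coincidence sets \<open>{x. S\<^sup>v x = T\<^sup>w x}\<close> contain them and are
  closed because a Cantor space is Hausdorff; they can overlap where \<open>T\<close> is not free, so they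
  are made disjoint along an enumeration of \<open>\<int>\<^sup>d\<close>.

  If \<open>F\<close> conjugates \<open>S\<close> to \<open>T2\<close>, pushing forward along \<open>F\<close> takes \<open>S\<close>-invariant measures, and
  in particular \<open>T1\<close>-invariant ones, to \<open>T2\<close>-invariant ones, and is undone by pushing forward
  along the inverse of \<open>F\<close>.  Dually, \<open>f \<mapsto> f \<circ> F\<close> is a bijection \<open>C(X2, \<int>) \<rightarrow> C(X1, \<int>)\<close>
  that matches nonnegative functions with nonnegative functions and 1 with 1, and by change of
  variables it maps \<open>Z_null T2\<close> into \<open>Z_null T1\<close>.  The homomorphism it induces on the quotients
  is the required one (\<open>dim_group_epi_if_pushforward\<close>).
\<close>

section \<open>Invariant measures and speedups\<close>

text \<open>A Cantor space is Hausdorff: two maps into it agree where all their binary coordinates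
  agree, and each coordinate takes values in the discrete space of truth values.\<close>

lemma closed_coincidence_set_if_cantor_space:
  fixes f g :: "'a::topological_space \<Rightarrow> 'a"
  assumes "cantor_space TYPE('a)" and f: "continuous_on UNIV f" and g: "continuous_on UNIV g"
  shows "closed {x. f x = g x}"
proof -
  obtain h k where hk: "homeomorphism UNIV (UNIV :: (nat \<Rightarrow> bool) set) (h :: 'a \<Rightarrow> _) k"
    using assms(1) unfolding cantor_space_def homeomorphic_def by blast
  then have inj: "h x = h y \<longleftrightarrow> x = y" for x y
    by (metis UNIV_I homeomorphism_apply1)
  have h: "continuous_on UNIV h" using hk by (rule homeomorphism_cont1)
  have "continuous_on UNIV (\<lambda>x. h (f x) i)" "continuous_on UNIV (\<lambda>x. h (g x) i)" for i
    using continuous_on_product_then_coordinatewise[OF continuous_on_compose2[OF h f subset_UNIV]]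
      continuous_on_product_then_coordinatewise[OF continuous_on_compose2[OF h g subset_UNIV]]
    by blast+
  then have "closed (\<Inter>i. {x. h (f x) i = h (g x) i})"
    by (intro closed_INT ballI closed_Collect_eq)
  also have "(\<Inter>i. {x. h (f x) i = h (g x) i}) = {x. f x = g x}"
    by (auto simp: fun_eq_iff simp flip: inj)
  finally show ?thesis .
qed

text \<open>A homeomorphism that is pieced together from countably many members of an action
  preserves the invariant measures of that action: it preserves measure on each piece, and both
  the pieces and their images partition the space.\<close>

lemma emeasure_vimage_eq_if_piecewise_in_action:
  fixes T :: "int ^ 'd \<Rightarrow> 'a \<Rightarrow> 'a::topological_space"
  assumes T: "zd_action T" and M: "M \<in> invariant_measures T"
    and S: "homeomorphism UNIV UNIV S R"
    and orbit: "\<And>x. \<exists>w. S x = T w x"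
    and closed: "\<And>w. closed {x. S x = T w x}"
    and A: "A \<in> sets borel"
  shows "emeasure M (S -` A) = emeasure M A"
proof -
  have sets_M [simp]: "sets M = sets borel" using M by (simp add: invariant_measures_def)
  have inj_T: "T w x = T w y \<longleftrightarrow> x = y" for w x y
    using T unfolding zd_action_def by (metis UNIV_I homeomorphism_apply1)
  have RS: "R (S x) = x" and SR: "S (R x) = x" for x
    using S by (auto simp: homeomorphism_def)
  have [measurable]: "S \<in> borel_measurable borel" "R \<in> borel_measurable borel"
    using S by (auto intro!: borel_measurable_continuous_onI dest: homeomorphism_cont1 homeomorphism_cont2)
  define B where "B = disjointed (\<lambda>n. {x. S x = T (from_nat n) x})"
  have B_sets: "B n \<in> sets borel" for n
    using sets.range_disjointed_sets[of "\<lambda>n. {x. S x = T (from_nat n) x}" borel] closed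
    unfolding B_def by (blast intro: borel_closed)
  have B_disj: "disjoint_family B"
    unfolding B_def by (rule disjoint_family_disjointed)
  have B_sub: "S x = T (from_nat n) x" if "x \<in> B n" for n x
    using that disjointed_subset[of "\<lambda>n. {x. S x = T (from_nat n) x}" n] unfolding B_def by blast
  have B_Un: "(\<Union>n. B n) = UNIV"
    unfolding B_def UN_disjointed_eq by (auto, metis orbit from_nat_to_nat)
  have SA: "S -` A \<in> sets borel"
    using measurable_sets[of S borel borel A] A by simp
  have RB: "R -` B n \<in> sets borel" for n
    using measurable_sets[of R borel borel "B n"] B_sets by simp
  have "emeasure M (S -` A) = emeasure M (\<Union>n. S -` A \<inter> B n)"
    using B_Un by (intro arg_cong[of _ _ "emeasure M"]) blast
  also have "\<dots> = (\<Sum>n. emeasure M (S -` A \<inter> B n))"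
    using SA B_sets B_disj
    by (intro suminf_emeasure[symmetric]) (auto simp: disjoint_family_on_def)
  also have "\<dots> = (\<Sum>n. emeasure M (A \<inter> R -` B n))"
  proof (rule suminf_cong)
    fix n
    \<comment> \<open>\<open>R -` B n\<close> is the image of the piece \<open>B n\<close> under \<open>S\<close>, and so also under \<open>T\<close>; writing
        it as a preimage shows that it is Borel.\<close>
    have "S -` A \<inter> B n = T (from_nat n) -` (A \<inter> R -` B n)"
    proof (intro subset_antisym subsetI)
      fix x assume "x \<in> S -` A \<inter> B n"
      then show "x \<in> T (from_nat n) -` (A \<inter> R -` B n)"
        using B_sub[of x n] RS[of x] by simp
    next
      fix x assume x: "x \<in> T (from_nat n) -` (A \<inter> R -` B n)"
      define y where "y = R (T (from_nat n) x)"
      have "y \<in> B n" "S y = T (from_nat n) x" using x by (auto simp: y_def SR)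
      moreover from this have "y = x" using B_sub[of y n] inj_T by simp
      ultimately show "x \<in> S -` A \<inter> B n" using x by simp
    qed
    moreover have "A \<inter> R -` B n \<in> sets borel"
      using A RB by blast
    ultimately show "emeasure M (S -` A \<inter> B n) = emeasure M (A \<inter> R -` B n)"
      using M unfolding invariant_measures_def by (simp del: vimage_Int)
  qed
  also have "\<dots> = emeasure M (\<Union>n. A \<inter> R -` B n)"
    using A RB B_disj by (intro suminf_emeasure) (auto simp: disjoint_family_on_def)
  also have "(\<Union>n. A \<inter> R -` B n) = A"
    using B_Un by blast
  finally show ?thesis .
qed

text \<open>The cocycle enters only through the inclusion of \<open>S\<close>-orbits in \<open>T\<close>-orbits.\<close>

lemma invariant_measures_subset_speedup:
  fixes T :: "int ^ 'd \<Rightarrow> 'a \<Rightarrow> 'a::topological_space" and S :: "int ^ 'e \<Rightarrow> 'a \<Rightarrow> 'a"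
  assumes cantor: "cantor_space TYPE('a)" and T: "zd_action T" and S: "speedup T S"
  shows "invariant_measures T \<subseteq> invariant_measures S"
proof
  fix M assume M: "M \<in> invariant_measures T"
  have "emeasure M (S v -` A) = emeasure M A" if "A \<in> sets borel" for v A
  proof -
    obtain R where R: "homeomorphism UNIV UNIV (S v) R"
      using S unfolding speedup_def zd_action_def by blast
    have "closed {x. S v x = T w x}" for w
    proof (rule closed_coincidence_set_if_cantor_space[OF cantor])
      show "continuous_on UNIV (S v)" using R by (rule homeomorphism_cont1)
      show "continuous_on UNIV (T w)"
        using T by (auto simp: zd_action_def dest: homeomorphism_cont1)
    qed
    moreover have "\<exists>w. S v x = T w x" for x
      using S by (auto simp: speedup_def)
    ultimately show ?thesis
      using emeasure_vimage_eq_if_piecewise_in_action[OF T M R _ _ that] by blast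
  qed
  with M show "M \<in> invariant_measures S"
    by (auto simp: invariant_measures_def)
qed

lemma distr_invariant_if_equivariant:
  fixes S :: "int ^ 'd \<Rightarrow> 'a \<Rightarrow> 'a::topological_space" and T :: "int ^ 'd \<Rightarrow> 'b \<Rightarrow> 'b::topological_space"
  assumes F: "continuous_on UNIV F" and equi: "\<And>v. F \<circ> S v = T v \<circ> F" and T: "zd_action T"
    and M: "M \<in> invariant_measures S"
  shows "distr M borel F \<in> invariant_measures T"
proof -
  interpret prob_space M using M by (simp add: invariant_measures_def)
  have sets_M: "sets M = sets borel" using M by (simp add: invariant_measures_def)
  then have space_M: "space M = UNIV" using sets_eq_imp_space_eq by fastforce
  have Fb: "F \<in> borel_measurable borel" using F by (rule borel_measurable_continuous_onI)
  then have Fm: "F \<in> borel_measurable M" using sets_M by (simp cong: measurable_cong_sets)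
  have "emeasure (distr M borel F) (T v -` A) = emeasure (distr M borel F) A"
    if A: "A \<in> sets borel" for v A
  proof -
    have "continuous_on UNIV (T v)"
      using T by (auto simp: zd_action_def dest: homeomorphism_cont1)
    then have TA: "T v -` A \<in> sets borel"
      using measurable_sets[OF borel_measurable_continuous_onI A, of "T v"] by simp
    have FA: "F -` A \<in> sets borel" using measurable_sets[OF Fb A] by simp
    have "emeasure (distr M borel F) (T v -` A) = emeasure M (F -` (T v -` A))"
      using Fm TA by (simp add: emeasure_distr space_M)
    also have "F -` (T v -` A) = S v -` (F -` A)"
      using equi[of v] by (auto simp: fun_eq_iff)
    also have "emeasure M \<dots> = emeasure M (F -` A)"
      using M FA by (simp add: invariant_measures_def)
    also have "\<dots> = emeasure (distr M borel F) A"
      using Fm A by (simp add: emeasure_distr space_M)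
    finally show ?thesis .
  qed
  then show ?thesis
    using prob_space_distr[OF Fm] by (simp add: invariant_measures_def)
qed

section \<open>Dimension groups\<close>

text \<open>Closure under addition uses that continuous integer-valued functions on a compact space
  are bounded, hence integrable; for other functions the integral could fail to be additive.\<close>

lemma normal_Z_null:
  fixes T :: "int ^ 'd \<Rightarrow> 'a \<Rightarrow> 'a::topological_space"
  assumes "cantor_space TYPE('a)"
  shows "Z_null T \<lhd> C_int"
proof -
  interpret C: comm_group C_int by (rule comm_group_C_int)
  note int = integrable_C_int[OF assms]
  have "subgroup (Z_null T) C_int"
  proof (rule C.subgroupI)
    have "(\<lambda>_. 0) \<in> Z_null T" by (simp add: Z_null_def C_int_def)
    then show "Z_null T \<noteq> {}" by blast
  next
    fix f assume f: "f \<in> Z_null T"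
    then have "inv\<^bsub>C_int\<^esub> f = (\<lambda>x. - f x)"
      using C_int_uminus[of f] by (intro C.inv_equality) (auto simp: C_int_def Z_null_def)
    then show "inv\<^bsub>C_int\<^esub> f \<in> Z_null T"
      using f C.inv_closed[of f] by (simp add: Z_null_def)
  next
    fix f g assume "f \<in> Z_null T" "g \<in> Z_null T"
    then show "f \<otimes>\<^bsub>C_int\<^esub> g \<in> Z_null T"
      using C.m_closed[of f g] by (simp add: Z_null_def int) (simp add: C_int_def int)
  qed (auto simp: Z_null_def)
  then show ?thesis by (rule C.subgroup_imp_normal)
qed

lemma comp_in_carrier_C_int:
  assumes "f \<in> carrier C_int" and "continuous_on UNIV F"
  shows "f \<circ> F \<in> carrier C_int"
  using assms continuous_on_compose[of UNIV F f] continuous_on_subset[of UNIV f]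
  by (auto simp: C_int_def)

text \<open>Change of variables: integrating \<open>f \<circ> F\<close> against an invariant measure of \<open>T1\<close> is
  integrating \<open>f\<close> against its pushforward, an invariant measure of \<open>T2\<close>.\<close>

lemma comp_in_Z_null:
  fixes T1 :: "int ^ 'd \<Rightarrow> 'a \<Rightarrow> 'a::topological_space" and T2 :: "int ^ 'e \<Rightarrow> 'b \<Rightarrow> 'b::topological_space"
  assumes F: "continuous_on UNIV F"
    and push: "\<And>M. M \<in> invariant_measures T1 \<Longrightarrow> distr M borel F \<in> invariant_measures T2"
    and f: "f \<in> Z_null T2"
  shows "f \<circ> F \<in> Z_null T1"
proof -
  have fC: "f \<in> carrier C_int" using f by (simp add: Z_null_def)
  have "(\<integral>x. real_of_int ((f \<circ> F) x) \<partial>M) = 0" if M: "M \<in> invariant_measures T1" for M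
  proof -
    have "F \<in> borel_measurable M"
      using borel_measurable_continuous_onI[OF F] M
      by (simp add: invariant_measures_def cong: measurable_cong_sets)
    moreover have "(\<lambda>y. real_of_int (f y)) \<in> borel_measurable borel"
      using fC by (intro borel_measurable_continuous_onI) (auto simp: C_int_def intro!: continuous_intros)
    ultimately have "(\<integral>y. real_of_int (f y) \<partial>distr M borel F) = (\<integral>x. real_of_int (f (F x)) \<partial>M)"
      by (rule integral_distr)
    with f push[OF M] show ?thesis by (simp add: Z_null_def)
  qed
  then show ?thesis
    using comp_in_carrier_C_int[OF fC F] by (simp add: Z_null_def)
qed

lemma carrier_dim_group: "carrier (dim_group T) = (\<lambda>f. Z_null T #>\<^bsub>C_int\<^esub> f) ` carrier C_int"
  by (simp add: dim_group_def carrier_FactGroup)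

text \<open>A nonnegative member of a coset can serve as its representative, which makes the positive
  cone an image under the quotient map, so that induced maps can be computed on it.\<close>

lemma dim_group_pos_eq:
  fixes T :: "int ^ 'd \<Rightarrow> 'a \<Rightarrow> 'a::topological_space"
  assumes "cantor_space TYPE('a)"
  shows "dim_group_pos T = (\<lambda>f. Z_null T #>\<^bsub>C_int\<^esub> f) ` {f \<in> carrier C_int. \<forall>x. f x \<ge> 0}"
proof -
  interpret N: normal "Z_null T" C_int using assms by (rule normal_Z_null)
  show ?thesis
  proof (intro subset_antisym subsetI)
    fix c assume c: "c \<in> dim_group_pos T"
    then obtain f where f: "f \<in> carrier C_int" "c = Z_null T #>\<^bsub>C_int\<^esub> f"
      unfolding dim_group_pos_def carrier_dim_group by blast
    obtain g where g: "g \<in> c" "g \<in> carrier C_int" "\<forall>x. g x \<ge> 0"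
      using c unfolding dim_group_pos_def by blast
    have "c = Z_null T #>\<^bsub>C_int\<^esub> g"
      using N.repr_independence[OF _ f(1) N.subgroup_axioms, of g] f(2) g(1) by simp
    with g show "c \<in> (\<lambda>f. Z_null T #>\<^bsub>C_int\<^esub> f) ` {f \<in> carrier C_int. \<forall>x. f x \<ge> 0}"
      by blast
  next
    fix c assume "c \<in> (\<lambda>f. Z_null T #>\<^bsub>C_int\<^esub> f) ` {f \<in> carrier C_int. \<forall>x. f x \<ge> 0}"
    then obtain f where f: "f \<in> carrier C_int" "\<forall>x. f x \<ge> 0" "c = Z_null T #>\<^bsub>C_int\<^esub> f"
      by blast
    then have "f \<in> c"
      using N.rcos_self[OF f(1) N.subgroup_axioms] by simp
    with f show "c \<in> dim_group_pos T"
      unfolding dim_group_pos_def carrier_dim_group by blast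
  qed
qed

text \<open>Only the pushforward property links the two actions.  As \<open>f \<mapsto> f \<circ> F\<close> is already onto the
  continuous functions, and onto the nonnegative ones, the induced map is onto the quotient and
  onto its positive cone.\<close>

lemma dim_group_epi_if_pushforward:
  fixes T1 :: "int ^ 'd \<Rightarrow> 'a \<Rightarrow> 'a::topological_space" and T2 :: "int ^ 'e \<Rightarrow> 'b \<Rightarrow> 'b::topological_space"
  assumes cantor: "cantor_space TYPE('a)" "cantor_space TYPE('b)"
    and FG: "homeomorphism UNIV UNIV F G"
    and push: "\<And>M. M \<in> invariant_measures T1 \<Longrightarrow> distr M borel F \<in> invariant_measures T2"
  shows "\<exists>\<phi> \<in> epi (dim_group T2) (dim_group T1).
           \<phi> ` dim_group_pos T2 = dim_group_pos T1 \<and> \<phi> (dim_group_unit T2) = dim_group_unit T1"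
proof -
  interpret N1: normal "Z_null T1" C_int using cantor(1) by (rule normal_Z_null)
  interpret N2: normal "Z_null T2" C_int using cantor(2) by (rule normal_Z_null)
  have F: "continuous_on UNIV F" and G: "continuous_on UNIV G"
    using FG by (auto dest: homeomorphism_cont1 homeomorphism_cont2)
  have GF: "f \<circ> G \<circ> F = f" for f :: "'a \<Rightarrow> int"
    using FG by (auto simp: homeomorphism_def)
  define h where "h f = Z_null T1 #>\<^bsub>C_int\<^esub> (f \<circ> F)" for f
  have "(\<lambda>f. f \<circ> F) \<in> hom C_int C_int"
    using comp_in_carrier_C_int[OF _ F] by (intro homI) (auto simp: C_int_def)
  then have "h \<in> hom C_int (dim_group T1)"
    using hom_compose[OF _ N1.r_coset_hom_Mod, of "\<lambda>f. f \<circ> F" C_int]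
    by (simp add: dim_group_def h_def[abs_def] comp_def[of "(#>\<^bsub>C_int\<^esub>) (Z_null T1)"])
  then interpret h: group_hom C_int "dim_group T1" h
    using N1.factorgroup_is_group N2.is_group
    by (simp add: group_hom_def group_hom_axioms_def dim_group_def)
  have ker: "Z_null T2 \<subseteq> kernel C_int (dim_group T1) h"
  proof
    fix f assume f: "f \<in> Z_null T2"
    have "f \<circ> F \<in> Z_null T1" by (rule comp_in_Z_null[OF F _ f]) (rule push)
    then have "h f = \<one>\<^bsub>dim_group T1\<^esub>"
      unfolding h_def dim_group_def one_FactGroup by (rule N1.rcos_const[OF N1.is_group])
    moreover have "f \<in> carrier C_int" using f by (rule N2.mem_carrier)
    ultimately show "f \<in> kernel C_int (dim_group T1) h"
      unfolding kernel_def by blast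
  qed
  obtain \<phi> where \<phi>_hom: "\<phi> \<in> hom (C_int Mod Z_null T2) (dim_group T1)"
    and \<phi>_h: "\<And>f. f \<in> carrier C_int \<Longrightarrow> \<phi> (Z_null T2 #>\<^bsub>C_int\<^esub> f) = h f"
  proof (rule h.FactGroup_universal_kernel[OF normal_Z_null[OF cantor(2)] ker])
    fix g assume g: "g \<in> hom (C_int Mod Z_null T2) (dim_group T1)"
      and g_h: "\<And>f. f \<in> carrier C_int \<Longrightarrow> g (Z_null T2 #>\<^bsub>C_int\<^esub> f) = h f"
    show thesis by (rule that[OF g]) (rule g_h)
  qed
  have hom: "\<phi> \<in> hom (dim_group T2) (dim_group T1)"
    using \<phi>_hom by (simp only: dim_group_def)
  have \<phi>: "\<phi> (Z_null T2 #>\<^bsub>C_int\<^esub> f) = Z_null T1 #>\<^bsub>C_int\<^esub> (f \<circ> F)" if "f \<in> carrier C_int" for f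
    using \<phi>_h[OF that] by (simp only: h_def)
  have onto: "(\<lambda>f. f \<circ> F) ` carrier C_int = carrier C_int"
  proof (intro subset_antisym subsetI)
    fix g :: "'a \<Rightarrow> int" assume "g \<in> carrier C_int"
    then show "g \<in> (\<lambda>f. f \<circ> F) ` carrier C_int"
      using comp_in_carrier_C_int[OF _ G] GF[of g] by (intro image_eqI[of _ _ "g \<circ> G"]) auto
  qed (use comp_in_carrier_C_int[OF _ F] in auto)
  have onto_pos: "(\<lambda>f. f \<circ> F) ` {f \<in> carrier C_int. \<forall>x. f x \<ge> 0} = {f \<in> carrier C_int. \<forall>x. f x \<ge> 0}"
  proof (intro subset_antisym subsetI)
    fix g :: "'a \<Rightarrow> int" assume "g \<in> {f \<in> carrier C_int. \<forall>x. f x \<ge> 0}"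
    then show "g \<in> (\<lambda>f. f \<circ> F) ` {f \<in> carrier C_int. \<forall>x. f x \<ge> 0}"
      using comp_in_carrier_C_int[OF _ G] GF[of g] by (intro image_eqI[of _ _ "g \<circ> G"]) auto
  qed (use comp_in_carrier_C_int[OF _ F] in auto)
  have "\<phi> ` carrier (dim_group T2) = (\<lambda>f. Z_null T1 #>\<^bsub>C_int\<^esub> f) ` (\<lambda>f. f \<circ> F) ` carrier C_int"
    unfolding carrier_dim_group image_image by (intro image_cong refl \<phi>)
  then have "\<phi> ` carrier (dim_group T2) = carrier (dim_group T1)"
    by (simp add: onto carrier_dim_group)
  moreover have "\<phi> ` dim_group_pos T2
      = (\<lambda>f. Z_null T1 #>\<^bsub>C_int\<^esub> f) ` (\<lambda>f. f \<circ> F) ` {f \<in> carrier C_int. \<forall>x. f x \<ge> 0}"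
    unfolding dim_group_pos_eq[OF cantor(2)] image_image by (intro image_cong refl) (simp add: \<phi>)
  then have "\<phi> ` dim_group_pos T2 = dim_group_pos T1"
    by (simp add: onto_pos dim_group_pos_eq[OF cantor(1)])
  moreover have "\<phi> (dim_group_unit T2) = dim_group_unit T1"
    using \<phi>[of "\<lambda>_. 1"] by (simp add: dim_group_unit_def C_int_def comp_def)
  ultimately show ?thesis
    using hom by (auto simp: epi_def)
qed

theorem theoremA:
  fixes T1 :: "int ^ 'd1 \<Rightarrow> 'a \<Rightarrow> 'a::topological_space"
    and T2 :: "int ^ 'd2 \<Rightarrow> 'b \<Rightarrow> 'b::topological_space"
  assumes "minimal_cantor_system T1"
    and "minimal_cantor_system T2"
    and "\<exists>S :: int ^ 'd2 \<Rightarrow> 'a \<Rightarrow> 'a. speedup T1 S \<and> conjugate_actions S T2"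
  shows "(\<exists>(F :: 'a \<Rightarrow> 'b) G. homeomorphism UNIV UNIV F G \<and>
            (\<lambda>M. distr M borel F) \<in> invariant_measures T1 \<rightarrow> invariant_measures T2 \<and>
            inj_on (\<lambda>M. distr M borel F) (invariant_measures T1)) \<and>
         (\<exists>\<phi> \<in> epi (dim_group T2) (dim_group T1).
            \<phi> ` dim_group_pos T2 = dim_group_pos T1 \<and>
            \<phi> (dim_group_unit T2) = dim_group_unit T1)"
proof -
  have cantor: "cantor_space TYPE('a)" "cantor_space TYPE('b)"
    and T: "zd_action T1" "zd_action T2"
    using assms(1,2) by (auto simp: minimal_cantor_system_def minimal_action_def)
  obtain S :: "int ^ 'd2 \<Rightarrow> 'a \<Rightarrow> 'a" and F G
    where S: "speedup T1 S" and FG: "homeomorphism UNIV UNIV F G"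
      and equi: "\<And>v. F \<circ> S v = T2 v \<circ> F"
    using assms(3) by (auto simp: conjugate_actions_def)
  have F: "F \<in> borel_measurable borel" and G: "G \<in> borel_measurable borel"
    using FG by (auto intro: borel_measurable_continuous_onI dest: homeomorphism_cont1 homeomorphism_cont2)
  have push: "distr M borel F \<in> invariant_measures T2" if "M \<in> invariant_measures T1" for M
    using that invariant_measures_subset_speedup[OF cantor(1) T(1) S]
      distr_invariant_if_equivariant[OF homeomorphism_cont1[OF FG] equi T(2)] by blast
  have "distr (distr M borel F) borel G = M" if "M \<in> invariant_measures T1" for M
  proof -
    have M: "sets M = sets borel" using that by (simp add: invariant_measures_def)
    then have "distr (distr M borel F) borel G = distr M borel (G \<circ> F)"
      using F G by (intro distr_distr) (simp_all cong: measurable_cong_sets)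
    also have "G \<circ> F = (\<lambda>x. x)"
      using FG by (auto simp: homeomorphism_def)
    also have "distr M borel (\<lambda>x. x) = M"
      using M by (simp add: distr_id2)
    finally show ?thesis .
  qed
  then have "inj_on (\<lambda>M. distr M borel F) (invariant_measures T1)"
    by (rule inj_on_inverseI)
  moreover have "\<exists>\<phi> \<in> epi (dim_group T2) (dim_group T1).
      \<phi> ` dim_group_pos T2 = dim_group_pos T1 \<and> \<phi> (dim_group_unit T2) = dim_group_unit T1"
    by (rule dim_group_epi_if_pushforward[OF cantor FG]) (rule push)
  ultimately show ?thesis
    using FG push by blast
qed

end
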